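(* Let $d,n\ge1$ and let $V,W:\mathbb C^n\to\mathbb C^d$ be isometries such that $$V^*TV=W^*TW\qquad\text{for all } T\in\mathcal T_d.$$ Assume that the unital completely positive map $\varphi:\mathcal T_d\to M_n$, $\varphi(T)=V^*TV$, is pure. Then there exists $\lambda\in\mathbb T$ such that $W=\lambda V$.
   Context: $\mathbb T$ is the unit circle in $\mathbb C$, $M_n=M_n(\mathbb C)$. $\mathcal T_d\subseteq M_d$ is the operator system of all $d\times d$ Toeplitz matrices $[a_{i-j}]_{i,j=0}^{d-1}$, $a_k\in\mathbb C$. CP means completely positive. For CP maps $\psi,\varphi:\mathcal T_d\to M_n$ write $\psi\le_{\mathrm{cp}}\varphi$ if $\varphi-\psi$ is CP. A nonzero CP map $\varphi$ is pure if every CP map $\psi\le_{\mathrm{cp}}\varphi$ is of the form $\psi=t\varphi$ for some $t\in[0,1]$. *)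

theory Defs
  imports "Jordan_Normal_Form.Schur_Decomposition"
begin

definition toeplitz :: "nat \<Rightarrow> complex mat set" where
  "toeplitz d = {mat d d (\<lambda>(i, j). a (int i - int j)) | a :: int \<Rightarrow> complex. True}"

definition isometry_mat :: "nat \<Rightarrow> nat \<Rightarrow> complex mat \<Rightarrow> bool" where
  "isometry_mat d n V \<longleftrightarrow> V \<in> carrier_mat d n \<and> mat_adjoint V * V = 1\<^sub>m n"

(* In the order on complex, 0 \<le> z means that z is real and nonnegative,
   so A is Hermitian by polarization. *)
definition psd :: "nat \<Rightarrow> complex mat \<Rightarrow> bool" where
  "psd m A \<longleftrightarrow> A \<in> carrier_mat m m \<and> (\<forall>v \<in> carrier_vec m. 0 \<le> (A *\<^sub>v v) \<bullet>c v)"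

(* Identifies the k by k matrix [A i j] with entries in M_m with an element of M_(k*m). *)
definition block_mat :: "nat \<Rightarrow> nat \<Rightarrow> (nat \<Rightarrow> nat \<Rightarrow> complex mat) \<Rightarrow> complex mat" where
  "block_mat k m A =
     mat (k * m) (k * m) (\<lambda>(r, s). A (r div m) (s div m) $$ (r mod m, s mod m))"

(* Maps on toeplitz d are represented by functions on the whole type;
   their values outside toeplitz d never matter. *)
definition linear_toeplitz :: "nat \<Rightarrow> nat \<Rightarrow> (complex mat \<Rightarrow> complex mat) \<Rightarrow> bool" where
  "linear_toeplitz d n \<phi> \<longleftrightarrow>
     (\<forall>T \<in> toeplitz d. \<phi> T \<in> carrier_mat n n) \<and>
     (\<forall>S \<in> toeplitz d. \<forall>T \<in> toeplitz d. \<phi> (S + T) = \<phi> S + \<phi> T) \<and>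
     (\<forall>c. \<forall>T \<in> toeplitz d. \<phi> (c \<cdot>\<^sub>m T) = c \<cdot>\<^sub>m \<phi> T)"

definition completely_positive :: "nat \<Rightarrow> nat \<Rightarrow> (complex mat \<Rightarrow> complex mat) \<Rightarrow> bool" where
  "completely_positive d n \<phi> \<longleftrightarrow>
     linear_toeplitz d n \<phi> \<and>
     (\<forall>k \<ge> 1. \<forall>A. (\<forall>i < k. \<forall>j < k. A i j \<in> toeplitz d) \<longrightarrow>
        psd (k * d) (block_mat k d A) \<longrightarrow>
        psd (k * n) (block_mat k n (\<lambda>i j. \<phi> (A i j))))"

definition cp_le ::
  "nat \<Rightarrow> nat \<Rightarrow> (complex mat \<Rightarrow> complex mat) \<Rightarrow> (complex mat \<Rightarrow> complex mat) \<Rightarrow> bool" where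
  "cp_le d n \<psi> \<phi> \<longleftrightarrow> completely_positive d n (\<lambda>T. \<phi> T - \<psi> T)"

definition pure_cp :: "nat \<Rightarrow> nat \<Rightarrow> (complex mat \<Rightarrow> complex mat) \<Rightarrow> bool" where
  "pure_cp d n \<phi> \<longleftrightarrow>
     completely_positive d n \<phi> \<and>
     (\<exists>T \<in> toeplitz d. \<phi> T \<noteq> 0\<^sub>m n n) \<and>
     (\<forall>\<psi>. completely_positive d n \<psi> \<longrightarrow> cp_le d n \<psi> \<phi> \<longrightarrow>
        (\<exists>t \<in> {0..1 :: real}. \<forall>T \<in> toeplitz d. \<psi> T = complex_of_real t \<cdot>\<^sub>m \<phi> T))"

end

theory Submission
  imports Defs
begin

text \<open>
  If \<open>V\<close> and \<open>W\<close> give the same compression \<open>\<phi>\<close> of \<open>toeplitz d\<close>, then for \<open>\<bar>c\<bar> = 1\<close> the compressions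
  by \<open>(V + c W)/2\<close> and \<open>(V - c W)/2\<close> add up to \<open>\<phi>\<close>, so by purity the former is a multiple of \<open>\<phi>\<close>.
  Taking \<open>c = 1\<close> and \<open>c = \<i>\<close> gives \<open>l\<close> with \<open>V\<^sup>* T (W - l V) = 0\<close> for every Toeplitz matrix \<open>T\<close>.
  Reading columns as coefficient vectors of polynomials, this says that \<open>cnj p * q = 0\<close> on the
  unit circle for every column \<open>p\<close> of \<open>V\<close> and every column \<open>q\<close> of \<open>W - l V\<close>. Since \<open>V \<noteq> 0\<close>, all
  \<open>q\<close> vanish, that is, \<open>W = l V\<close>.
\<close>

section \<open>Toeplitz matrices and maps on their span\<close>

lemma toeplitz_carrier: "T \<in> toeplitz d \<Longrightarrow> T \<in> carrier_mat d d"
  by (auto simp: toeplitz_def)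

lemma toeplitz_mat: "mat d d (\<lambda>(i, j). a (int i - int j)) \<in> toeplitz d"
  unfolding toeplitz_def by blast

lemma toeplitz_add:
  assumes "S \<in> toeplitz d" "T \<in> toeplitz d"
  shows "S + T \<in> toeplitz d"
proof -
  obtain a b where "S = mat d d (\<lambda>(i, j). a (int i - int j))"
    and "T = mat d d (\<lambda>(i, j). b (int i - int j))"
    using assms unfolding toeplitz_def by blast
  then have "S + T = mat d d (\<lambda>(i, j). (\<lambda>k. a k + b k) (int i - int j))"
    by (intro eq_matI) auto
  then show ?thesis using toeplitz_mat [of d "\<lambda>k. a k + b k"] by simp
qed

lemma toeplitz_smult:
  assumes "T \<in> toeplitz d"
  shows "c \<cdot>\<^sub>m T \<in> toeplitz d"
proof -
  obtain a where "T = mat d d (\<lambda>(i, j). a (int i - int j))"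
    using assms unfolding toeplitz_def by blast
  then have "c \<cdot>\<^sub>m T = mat d d (\<lambda>(i, j). (\<lambda>k. c * a k) (int i - int j))"
    by (intro eq_matI) auto
  then show ?thesis using toeplitz_mat [of d "\<lambda>k. c * a k"] by simp
qed

lemma block_mat_cong:
  assumes "\<And>i j. i < k \<Longrightarrow> j < k \<Longrightarrow> A i j = B i j"
  shows "block_mat k m A = block_mat k m B"
  unfolding block_mat_def
  by (intro cong_mat) (auto simp: assms less_mult_imp_div_less)

text \<open>Every clause of \<open>completely_positive\<close> evaluates the map on
  \<open>toeplitz d\<close> only, a set closed under sums and multiples. Hence agreement there
  suffices, although the functions may differ elsewhere.\<close>

lemma completely_positive_cong:
  assumes "completely_positive d n \<phi>" and eq: "\<And>T. T \<in> toeplitz d \<Longrightarrow> \<phi> T = \<psi> T"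
  shows "completely_positive d n \<psi>"
proof -
  have "linear_toeplitz d n \<psi>"
    using assms(1) unfolding completely_positive_def linear_toeplitz_def
    by (simp add: eq [symmetric] toeplitz_add toeplitz_smult)
  moreover have "psd (k * n) (block_mat k n (\<lambda>i j. \<psi> (A i j)))"
    if "k \<ge> 1" "\<forall>i < k. \<forall>j < k. A i j \<in> toeplitz d" "psd (k * d) (block_mat k d A)" for k A
  proof -
    have "psd (k * n) (block_mat k n (\<lambda>i j. \<phi> (A i j)))"
      using assms(1) that unfolding completely_positive_def by blast
    also have "block_mat k n (\<lambda>i j. \<phi> (A i j)) = block_mat k n (\<lambda>i j. \<psi> (A i j))"
      using that by (intro block_mat_cong) (simp add: eq)
    finally show ?thesis .
  qed
  ultimately show ?thesis unfolding completely_positive_def by blast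
qed

section \<open>Adjoints and compressions\<close>

text \<open>The entrywise form lets products with an adjoint unfold into finite sums.\<close>

lemma mat_adjoint_eq_mat:
  "mat_adjoint X = mat (dim_col X) (dim_row X) (\<lambda>(a, i). cnj (X $$ (i, a)))"
  by (intro eq_matI) (auto simp: mat_adjoint_def mat_of_rows_def)

lemma mat_adjoint_carrier:
  fixes X :: "complex mat"
  shows "X \<in> carrier_mat d n \<Longrightarrow> mat_adjoint X \<in> carrier_mat n d"
  by (rule carrier_matI) (auto simp: mat_adjoint_eq_mat)

lemma cscalar_prod_mat_adjoint:
  fixes X :: "complex mat"
  assumes "X \<in> carrier_mat d n" "u \<in> carrier_vec d" "v \<in> carrier_vec n"
  shows "(mat_adjoint X *\<^sub>v u) \<bullet>c v = u \<bullet>c (X *\<^sub>v v)"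
proof -
  have "(mat_adjoint X *\<^sub>v u) \<bullet>c v = (\<Sum>a<n. \<Sum>i<d. cnj (X $$ (i, a)) * u $ i * cnj (v $ a))"
    using assms
    by (simp add: mat_adjoint_eq_mat scalar_prod_def sum_distrib_right atLeast0LessThan)
  also have "\<dots> = (\<Sum>i<d. \<Sum>a<n. cnj (X $$ (i, a)) * u $ i * cnj (v $ a))"
    by (rule sum.swap)
  also have "\<dots> = u \<bullet>c (X *\<^sub>v v)"
    using assms
    by (simp add: scalar_prod_def sum_distrib_left atLeast0LessThan mult_ac)
  finally show ?thesis .
qed

lemma compression_entry:
  fixes X Y T :: "complex mat"
  assumes "X \<in> carrier_mat d n" "Y \<in> carrier_mat d n" "T \<in> carrier_mat d d" "a < n" "b < n"
  shows "(mat_adjoint X * T * Y) $$ (a, b)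
    = (\<Sum>j<d. \<Sum>i<d. cnj (X $$ (i, a)) * T $$ (i, j) * Y $$ (j, b))"
  using assms
  by (simp add: mat_adjoint_eq_mat scalar_prod_def sum_distrib_right atLeast0LessThan)

lemma compression_linear:
  assumes X: "X \<in> carrier_mat d n"
  shows "linear_toeplitz d n (\<lambda>T. mat_adjoint X * T * X)"
proof -
  have X': "mat_adjoint X \<in> carrier_mat n d" using X by (rule mat_adjoint_carrier)
  show ?thesis
    unfolding linear_toeplitz_def
  proof (intro conjI ballI allI)
    fix S T c assume "S \<in> toeplitz d" "T \<in> toeplitz d"
    then have S: "S \<in> carrier_mat d d" and T: "T \<in> carrier_mat d d"
      by (auto dest: toeplitz_carrier)
    show "mat_adjoint X * T * X \<in> carrier_mat n n" using X X' T by auto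
    show "mat_adjoint X * (S + T) * X = mat_adjoint X * S * X + mat_adjoint X * T * X"
      using mult_add_distrib_mat [OF X' S T]
        add_mult_distrib_mat [OF mult_carrier_mat [OF X' S] mult_carrier_mat [OF X' T] X]
      by simp
    show "mat_adjoint X * (c \<cdot>\<^sub>m T) * X = c \<cdot>\<^sub>m (mat_adjoint X * T * X)"
      using mult_smult_distrib [OF X' T] mult_smult_assoc_mat [OF mult_carrier_mat [OF X' T] X]
      by simp
  qed
qed

section \<open>Complete positivity of compressions\<close>

text \<open>Slices a vector by the same index convention that \<open>block_mat\<close> encodes with
  \<open>div\<close> and \<open>mod\<close>.\<close>

definition block_vec :: "nat \<Rightarrow> complex vec \<Rightarrow> nat \<Rightarrow> complex vec" where
  "block_vec m v i = vec m (\<lambda>a. v $ (i * m + a))"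

lemma block_vec_carrier: "block_vec m v i \<in> carrier_vec m"
  by (simp add: block_vec_def)

lemma block_index_less:
  fixes i k m a :: nat
  assumes "i < k" "a < m"
  shows "i * m + a < k * m"
proof -
  have "i * m + a < Suc i * m" using assms by simp
  also have "\<dots> \<le> k * m" using assms by (intro mult_le_mono1) simp
  finally show ?thesis .
qed

lemma sum_blocks:
  fixes f :: "nat \<Rightarrow> 'a :: comm_monoid_add"
  shows "(\<Sum>r<k * m. f r) = (\<Sum>i<k. \<Sum>a<m. f (i * m + a))"
proof -
  have "sum f {i * m..<i * m + m} = (\<Sum>a<m. f (i * m + a))" for i
    using sum.shift_bounds_nat_ivl [of f 0 "i * m" m] by (simp add: add.commute atLeast0LessThan)
  then show ?thesis by (simp add: sum.nat_group [symmetric])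
qed

text \<open>Reduces positivity at level \<open>k\<close> to forms in single blocks, where a
  compression can be moved from the matrix to the vectors.\<close>

lemma block_mat_form:
  assumes A: "\<And>i j. i < k \<Longrightarrow> j < k \<Longrightarrow> A i j \<in> carrier_mat m m"
    and v: "v \<in> carrier_vec (k * m)"
  shows "(block_mat k m A *\<^sub>v v) \<bullet>c v
    = (\<Sum>i<k. \<Sum>j<k. (A i j *\<^sub>v block_vec m v j) \<bullet>c block_vec m v i)"
proof -
  have "(block_mat k m A *\<^sub>v v) \<bullet>c v
      = (\<Sum>r<k * m. \<Sum>s<k * m. A (r div m) (s div m) $$ (r mod m, s mod m) * v $ s * cnj (v $ r))"
    using v by (simp add: block_mat_def scalar_prod_def sum_distrib_right atLeast0LessThan)
  also have "\<dots> = (\<Sum>i<k. \<Sum>a<m. \<Sum>j<k. \<Sum>b<m.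
      A i j $$ (a, b) * v $ (j * m + b) * cnj (v $ (i * m + a)))"
    unfolding sum_blocks by (intro sum.cong refl) simp
  also have "\<dots> = (\<Sum>i<k. \<Sum>j<k. \<Sum>a<m. \<Sum>b<m.
      A i j $$ (a, b) * v $ (j * m + b) * cnj (v $ (i * m + a)))"
    by (intro sum.cong refl sum.swap)
  also have "\<dots> = (\<Sum>i<k. \<Sum>j<k. (A i j *\<^sub>v block_vec m v j) \<bullet>c block_vec m v i)"
  proof (intro sum.cong refl)
    fix i j assume "i \<in> {..<k}" "j \<in> {..<k}"
    then have "A i j \<in> carrier_mat m m" using A by simp
    then show "(\<Sum>a<m. \<Sum>b<m. A i j $$ (a, b) * v $ (j * m + b) * cnj (v $ (i * m + a)))
        = (A i j *\<^sub>v block_vec m v j) \<bullet>c block_vec m v i"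
      by (simp add: block_vec_def scalar_prod_def sum_distrib_right atLeast0LessThan)
  qed
  finally show ?thesis .
qed

text \<open>At level \<open>k\<close> the map is compression by the block diagonal matrix with
  \<open>k\<close> copies of \<open>X\<close>, so its form at \<open>v\<close> is the form of
  \<open>A\<close> at the image of \<open>v\<close> under that matrix.\<close>

lemma compression_completely_positive:
  assumes X: "X \<in> carrier_mat d n"
  shows "completely_positive d n (\<lambda>T. mat_adjoint X * T * X)"
  unfolding completely_positive_def
proof (intro conjI allI impI compression_linear [OF X])
  fix k A
  assume "\<forall>i<k. \<forall>j<k. A i j \<in> toeplitz d" and psd: "psd (k * d) (block_mat k d A)"
  then have A: "A i j \<in> carrier_mat d d" if "i < k" "j < k" for i j
    using that toeplitz_carrier by blast
  have X': "mat_adjoint X \<in> carrier_mat n d" using X by (rule mat_adjoint_carrier)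
  have "0 \<le> (block_mat k n (\<lambda>i j. mat_adjoint X * A i j * X) *\<^sub>v v) \<bullet>c v"
    if v: "v \<in> carrier_vec (k * n)" for v
  proof -
    \<comment> \<open>Apply \<open>X\<close> to each block of \<open>v\<close>.\<close>
    define w where "w = vec (k * d) (\<lambda>r. (X *\<^sub>v block_vec n v (r div d)) $ (r mod d))"
    have w: "w \<in> carrier_vec (k * d)" by (simp add: w_def)
    have w_block: "block_vec d w i = X *\<^sub>v block_vec n v i" if "i < k" for i
      using X that by (intro eq_vecI) (auto simp: block_vec_def w_def block_index_less)
    have "(block_mat k n (\<lambda>i j. mat_adjoint X * A i j * X) *\<^sub>v v) \<bullet>c v
        = (\<Sum>i<k. \<Sum>j<k. ((mat_adjoint X * A i j * X) *\<^sub>v block_vec n v j) \<bullet>c block_vec n v i)"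
      using X X' A v by (intro block_mat_form) auto
    also have "\<dots> = (\<Sum>i<k. \<Sum>j<k. (A i j *\<^sub>v block_vec d w j) \<bullet>c block_vec d w i)"
    proof (intro sum.cong refl)
      fix i j assume ij: "i \<in> {..<k}" "j \<in> {..<k}"
      have Xv: "X *\<^sub>v block_vec n v j \<in> carrier_vec d" using X by (auto simp: block_vec_def)
      have "(mat_adjoint X * A i j * X) *\<^sub>v block_vec n v j
          = mat_adjoint X *\<^sub>v (A i j *\<^sub>v (X *\<^sub>v block_vec n v j))"
        using X X' A [of i j] ij Xv block_vec_carrier [of n v j]
        by (simp add: assoc_mult_mat_vec [of _ n d _ n] assoc_mult_mat_vec [of _ n d _ d])
      then show "((mat_adjoint X * A i j * X) *\<^sub>v block_vec n v j) \<bullet>c block_vec n v i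
          = (A i j *\<^sub>v block_vec d w j) \<bullet>c block_vec d w i"
        using cscalar_prod_mat_adjoint [OF X _ block_vec_carrier] A [of i j] ij Xv
        by (simp add: w_block)
    qed
    also have "\<dots> = (block_mat k d A *\<^sub>v w) \<bullet>c w"
      using A w by (intro block_mat_form [symmetric]) auto
    finally show ?thesis using psd w unfolding psd_def by simp
  qed
  then show "psd (k * n) (block_mat k n (\<lambda>i j. mat_adjoint X * A i j * X))"
    unfolding psd_def by (simp add: block_mat_def)
qed

section \<open>Separation by Toeplitz forms\<close>

text \<open>
  The Laurent polynomial with the coefficients \<open>\<Sum>i - j = k. cnj (u i) * w j\<close> has the extreme
  coefficient \<open>cnj (u i0) * w j0\<close>, where \<open>i0\<close> is the last index in the support of \<open>u\<close> and \<open>j0\<close> the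
  first one in the support of \<open>w\<close>.
\<close>
lemma toeplitz_forms_separate:
  fixes u w :: "nat \<Rightarrow> complex"
  assumes zero: "\<And>T. T \<in> toeplitz d \<Longrightarrow> (\<Sum>j<d. \<Sum>i<d. cnj (u i) * T $$ (i, j) * w j) = 0"
    and u: "i < d" "u i \<noteq> 0"
  shows "\<forall>j<d. w j = 0"
proof (rule ccontr)
  assume "\<not> (\<forall>j<d. w j = 0)"
  then have ex: "\<exists>j. j < d \<and> w j \<noteq> 0" by blast
  define j0 where "j0 = (LEAST j. j < d \<and> w j \<noteq> 0)"
  define i0 where "i0 = Max {i. i < d \<and> u i \<noteq> 0}"
  have j0: "j0 < d" "w j0 \<noteq> 0" using LeastI_ex [OF ex] by (auto simp: j0_def)
  have j0_least: "j0 \<le> j" if "j < d" "w j \<noteq> 0" for j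
    unfolding j0_def using that by (intro Least_le) simp
  have "i0 \<in> {i. i < d \<and> u i \<noteq> 0}" unfolding i0_def using u by (intro Max_in) auto
  then have i0: "i0 < d" "u i0 \<noteq> 0" by auto
  have i0_greatest: "i \<le> i0" if "i < d" "u i \<noteq> 0" for i
    unfolding i0_def using that by (intro Max_ge) auto
  \<comment> \<open>The Toeplitz matrix supported on the single diagonal \<open>i0 - j0\<close>
    extracts the extreme coefficient from the form.\<close>
  define a where "a k = (if k = int i0 - int j0 then 1 else 0 :: complex)" for k
  define T where "T = mat d d (\<lambda>(i, j). a (int i - int j))"
  have "T \<in> toeplitz d" unfolding T_def by (rule toeplitz_mat)
  then have "0 = (\<Sum>j<d. \<Sum>i<d. cnj (u i) * T $$ (i, j) * w j)" using zero by simp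
  also have "\<dots> = (\<Sum>j<d. \<Sum>i<d. if j = j0 then if i = i0 then cnj (u i0) * w j0 else 0 else 0)"
  proof (intro sum.cong refl)
    fix j i assume ij: "j \<in> {..<d}" "i \<in> {..<d}"
    show "cnj (u i) * T $$ (i, j) * w j
        = (if j = j0 then if i = i0 then cnj (u i0) * w j0 else 0 else 0)"
    proof (cases "u i = 0 \<or> w j = 0")
      case True
      then show ?thesis using i0 j0 by auto
    next
      case False
      then have "j0 \<le> j" "i \<le> i0" using ij j0_least i0_greatest by auto
      \<comment> \<open>On the supports \<open>i - i0\<close> and \<open>j0 - j\<close> are both at
        most 0, so their sum vanishes only if each does.\<close>
      then have "int i - int j = int i0 - int j0 \<longleftrightarrow> i = i0 \<and> j = j0" by auto
      then show ?thesis using ij by (simp add: T_def a_def)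
    qed
  qed
  also have "\<dots> = (\<Sum>j<d. if j = j0 then \<Sum>i<d. if i = i0 then cnj (u i0) * w j0 else 0 else 0)"
    by (intro sum.cong refl) simp
  also have "\<dots> = cnj (u i0) * w j0"
    using i0 j0 by simp
  finally show False using i0 j0 by simp
qed

section \<open>Purity applied to half sums\<close>

text \<open>With the factor 1/2, the parallelogram law makes the compressions for \<open>c\<close>
  and \<open>- c\<close> add up to the common one when \<open>c\<close> has modulus 1.\<close>

definition half_sum :: "complex \<Rightarrow> complex mat \<Rightarrow> complex mat \<Rightarrow> complex mat" where
  "half_sum c V W = (1 / 2) \<cdot>\<^sub>m (V + c \<cdot>\<^sub>m W)"

lemma half_sum_carrier:
  "V \<in> carrier_mat d n \<Longrightarrow> W \<in> carrier_mat d n \<Longrightarrow> half_sum c V W \<in> carrier_mat d n"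
  by (simp add: half_sum_def)

lemma half_sum_compression_entry:
  assumes "V \<in> carrier_mat d n" "W \<in> carrier_mat d n" "T \<in> carrier_mat d d" "a < n" "b < n"
  shows "(mat_adjoint (half_sum c V W) * T * half_sum c V W) $$ (a, b)
    = ((mat_adjoint V * T * V) $$ (a, b) + c * (mat_adjoint V * T * W) $$ (a, b)
      + cnj c * (mat_adjoint W * T * V) $$ (a, b)
      + cnj c * c * (mat_adjoint W * T * W) $$ (a, b)) / 4"
proof -
  have "(mat_adjoint (half_sum c V W) * T * half_sum c V W) $$ (a, b)
      = (\<Sum>j<d. \<Sum>i<d. cnj (half_sum c V W $$ (i, a)) * T $$ (i, j) * half_sum c V W $$ (j, b))"
    using assms by (intro compression_entry half_sum_carrier)
  also have "\<dots> = (\<Sum>j<d. \<Sum>i<d.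
      (cnj (V $$ (i, a)) * T $$ (i, j) * V $$ (j, b)
      + c * (cnj (V $$ (i, a)) * T $$ (i, j) * W $$ (j, b))
      + cnj c * (cnj (W $$ (i, a)) * T $$ (i, j) * V $$ (j, b))
      + cnj c * c * (cnj (W $$ (i, a)) * T $$ (i, j) * W $$ (j, b))) / 4)"
    using assms by (intro sum.cong refl) (simp add: half_sum_def field_simps)
  also have "\<dots> = ((mat_adjoint V * T * V) $$ (a, b) + c * (mat_adjoint V * T * W) $$ (a, b)
      + cnj c * (mat_adjoint W * T * V) $$ (a, b)
      + cnj c * c * (mat_adjoint W * T * W) $$ (a, b)) / 4"
    using assms
    by (simp add: compression_entry sum.distrib sum_distrib_left sum_divide_distrib
        add_divide_distrib)
  finally show ?thesis .
qed

text \<open>The compression by \<open>half_sum c V W\<close> is half the original one plus a quarter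
  of the cross terms. Purity makes it a multiple of the original, hence so are the cross
  terms.\<close>

lemma pure_compression_cross_term:
  assumes V: "V \<in> carrier_mat d n" and W: "W \<in> carrier_mat d n"
    and eq: "\<And>T. T \<in> toeplitz d \<Longrightarrow> mat_adjoint V * T * V = mat_adjoint W * T * W"
    and pure: "pure_cp d n (\<lambda>T. mat_adjoint V * T * V)"
    and c: "cnj c * c = 1"
  obtains r :: complex where "\<And>T a b. T \<in> toeplitz d \<Longrightarrow> a < n \<Longrightarrow> b < n \<Longrightarrow>
    c * (mat_adjoint V * T * W) $$ (a, b) + cnj c * (mat_adjoint W * T * V) $$ (a, b)
      = r * (mat_adjoint V * T * V) $$ (a, b)"
proof -
  let ?\<phi> = "\<lambda>T. mat_adjoint V * T * V"
  let ?\<psi> = "\<lambda>c T. mat_adjoint (half_sum c V W) * T * half_sum c V W"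
  have dims: "mat_adjoint V \<in> carrier_mat n d"
    "mat_adjoint (half_sum c V W) \<in> carrier_mat n d" for c
    using V W by (auto intro!: mat_adjoint_carrier half_sum_carrier)
  \<comment> \<open>Stated for any \<open>c'\<close> of modulus 1, to be used with both
    \<open>c\<close> and \<open>- c\<close>.\<close>
  have entry: "?\<psi> c' T $$ (a, b) = ?\<phi> T $$ (a, b) / 2
      + (c' * (mat_adjoint V * T * W) $$ (a, b) + cnj c' * (mat_adjoint W * T * V) $$ (a, b)) / 4"
    if "T \<in> toeplitz d" "a < n" "b < n" "cnj c' * c' = 1" for T a b c'
    unfolding half_sum_compression_entry [OF V W toeplitz_carrier [OF that(1)] that(2,3)]
      eq [OF that(1)] that(4)
    by (simp add: field_simps)
  have "?\<psi> (- c) T = ?\<phi> T - ?\<psi> c T" if "T \<in> toeplitz d" for T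
  proof (intro eq_matI)
    fix a b assume "a < dim_row (?\<phi> T - ?\<psi> c T)" "b < dim_col (?\<phi> T - ?\<psi> c T)"
    then have ab: "a < n" "b < n"
      using dims(2) [of c] half_sum_carrier [OF V W, of c] by auto
    have "(?\<phi> T - ?\<psi> c T) $$ (a, b) = ?\<phi> T $$ (a, b) - ?\<psi> c T $$ (a, b)"
      using ab dims(2) [of c] half_sum_carrier [OF V W, of c] by auto
    moreover have "?\<psi> (- c) T $$ (a, b) + ?\<psi> c T $$ (a, b) = ?\<phi> T $$ (a, b)"
      using c by (simp add: entry [OF that ab] field_simps)
    ultimately show "?\<psi> (- c) T $$ (a, b) = (?\<phi> T - ?\<psi> c T) $$ (a, b)"
      by (metis eq_diff_eq)
  qed (simp_all add: carrier_matD [OF dims(2)] carrier_matD [OF half_sum_carrier [OF V W]])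
  \<comment> \<open>The difference is again a compression on \<open>toeplitz d\<close>, namely by
    the half sum for \<open>- c\<close>.\<close>
  then have "cp_le d n (?\<psi> c) ?\<phi>"
    unfolding cp_le_def
    by (intro completely_positive_cong [OF compression_completely_positive, of "half_sum (- c) V W"]
        half_sum_carrier V W) auto
  moreover have "completely_positive d n (?\<psi> c)"
    by (intro compression_completely_positive half_sum_carrier V W)
  ultimately obtain t :: real
    where t: "\<forall>T \<in> toeplitz d. ?\<psi> c T = complex_of_real t \<cdot>\<^sub>m ?\<phi> T"
    using pure unfolding pure_cp_def by blast
  \<comment> \<open>Solving \<open>t * z = z / 2 + x / 4\<close> for the cross term \<open>x\<close>
    gives \<open>x = (4 * t - 2) * z\<close>.\<close>
  show thesis
  proof (rule that [of "4 * complex_of_real t - 2"])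
    fix T a b assume T: "T \<in> toeplitz d" and ab: "a < n" "b < n"
    have "?\<psi> c T $$ (a, b) = complex_of_real t * ?\<phi> T $$ (a, b)"
      using t T ab V dims by auto
    then show "c * (mat_adjoint V * T * W) $$ (a, b) + cnj c * (mat_adjoint W * T * V) $$ (a, b)
        = (4 * complex_of_real t - 2) * ?\<phi> T $$ (a, b)"
      using entry [OF T ab c]
      by (simp add: field_simps)
  qed
qed

theorem corollary5p4:
  fixes d n :: nat and V W :: "complex mat"
  assumes "d \<ge> 1" and "n \<ge> 1"
    and "isometry_mat d n V" and "isometry_mat d n W"
    and "\<forall>T \<in> toeplitz d. mat_adjoint V * T * V = mat_adjoint W * T * W"
    and "pure_cp d n (\<lambda>T. mat_adjoint V * T * V)"
  shows "\<exists>l :: complex. cmod l = 1 \<and> W = l \<cdot>\<^sub>m V"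
proof -
  have V: "V \<in> carrier_mat d n" and W: "W \<in> carrier_mat d n"
    using assms(3,4) by (auto simp: isometry_mat_def)
  have eq: "mat_adjoint V * T * V = mat_adjoint W * T * W" if "T \<in> toeplitz d" for T
    using assms(5) that by blast
  obtain r where r: "\<And>T a b. T \<in> toeplitz d \<Longrightarrow> a < n \<Longrightarrow> b < n \<Longrightarrow>
      (mat_adjoint V * T * W) $$ (a, b) + (mat_adjoint W * T * V) $$ (a, b)
        = r * (mat_adjoint V * T * V) $$ (a, b)"
    using pure_compression_cross_term [OF V W eq assms(6), of 1] by auto
  obtain s where s: "\<And>T a b. T \<in> toeplitz d \<Longrightarrow> a < n \<Longrightarrow> b < n \<Longrightarrow>
      \<i> * (mat_adjoint V * T * W) $$ (a, b) - \<i> * (mat_adjoint W * T * V) $$ (a, b)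
        = s * (mat_adjoint V * T * V) $$ (a, b)"
    using pure_compression_cross_term [OF V W eq assms(6), of \<i>] by auto
  \<comment> \<open>For the entries x, y, z named below, the two relations are x + y = r z and x - y
    = -\<i> s z; adding them isolates x.\<close>
  define l where "l = (r - \<i> * s) / 2"
  have cross: "(mat_adjoint V * T * W) $$ (a, b) = l * (mat_adjoint V * T * V) $$ (a, b)"
    if "T \<in> toeplitz d" "a < n" "b < n" for T a b
  proof -
    let ?x = "(mat_adjoint V * T * W) $$ (a, b)" and ?y = "(mat_adjoint W * T * V) $$ (a, b)"
      and ?z = "(mat_adjoint V * T * V) $$ (a, b)"
    have "2 * ?x = (?x + ?y) - \<i> * (\<i> * ?x - \<i> * ?y)"
      by (simp add: algebra_simps)
    also have "\<dots> = r * ?z - \<i> * (s * ?z)" by (simp only: r [OF that] s [OF that])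
    finally show ?thesis by (simp add: l_def field_simps)
  qed
  \<comment> \<open>Column 0 exists as \<open>n\<close> is positive, and it has norm 1. This gives a
    nonzero entry of \<open>V\<close> and, later, the modulus of \<open>l\<close>.\<close>
  have gram: "(\<Sum>i<d. cnj (X $$ (i, 0)) * X $$ (i, 0)) = 1" if "isometry_mat d n X" for X
  proof -
    have "(mat_adjoint X * X) $$ (0, 0) = (1\<^sub>m n :: complex mat) $$ (0, 0)"
      using that by (simp add: isometry_mat_def)
    moreover have "X \<in> carrier_mat d n" using that by (simp add: isometry_mat_def)
    ultimately show ?thesis using assms(2)
      by (simp add: mat_adjoint_eq_mat scalar_prod_def atLeast0LessThan)
  qed
  obtain i where i: "i < d" "V $$ (i, 0) \<noteq> 0"
    using gram [OF assms(3)] by (metis (no_types, lifting) lessThan_iff mult_zero_right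
        sum.neutral zero_neq_one)
  have entries: "W $$ (j, b) = l * V $$ (j, b)" if "j < d" "b < n" for j b
  proof -
    \<comment> \<open>One nonzero column of \<open>V\<close>, here column 0, is enough to force
      column \<open>b\<close> of \<open>W - l V\<close> to vanish.\<close>
    have "(\<Sum>j<d. \<Sum>i<d. cnj (V $$ (i, 0)) * T $$ (i, j) * (W $$ (j, b) - l * V $$ (j, b))) = 0"
      if T: "T \<in> toeplitz d" for T
    proof -
      have "(\<Sum>j<d. \<Sum>i<d. cnj (V $$ (i, 0)) * T $$ (i, j) * (W $$ (j, b) - l * V $$ (j, b)))
          = (mat_adjoint V * T * W) $$ (0, b) - l * (mat_adjoint V * T * V) $$ (0, b)"
        using V W toeplitz_carrier [OF T] assms(2) \<open>b < n\<close>
        by (simp add: compression_entry sum_subtractf sum_distrib_left algebra_simps)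
      then show ?thesis using cross [OF T, of 0 b] assms(2) \<open>b < n\<close> by simp
    qed
    from toeplitz_forms_separate [OF this i] \<open>j < d\<close> show ?thesis by simp
  qed
  have "W = l \<cdot>\<^sub>m V"
    using V W entries by (intro eq_matI) auto
  moreover have "cnj l * l = 1"
  proof -
    \<comment> \<open>Compare the norms of the first columns of \<open>W = l V\<close> and
      \<open>V\<close>.\<close>
    have "1 = (\<Sum>i<d. cnj (W $$ (i, 0)) * W $$ (i, 0))" using gram [OF assms(4)] by simp
    also have "\<dots> = cnj l * l * (\<Sum>i<d. cnj (V $$ (i, 0)) * V $$ (i, 0))"
      using entries assms(2) by (simp add: sum_distrib_left mult_ac)
    finally show ?thesis using gram [OF assms(3)] by simp
  qed
  then have "(cmod l)\<^sup>2 = 1"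
    by (metis complex_mod_cnj norm_mult norm_one power2_eq_square)
  then have "cmod l = 1"
    using norm_ge_zero [of l] by (auto simp: power2_eq_1_iff simp del: norm_ge_zero)
  ultimately show ?thesis by blast
qed

end
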